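(* Let $h$ and $l$ be real-valued functions on subsets of $V$ such that for all disjoint $\mathcal{C}_1,\mathcal{C}_2$: $h(\mathcal{C}_1 \cup \mathcal{C}_2) \geq h(\mathcal{C}_1) + h(\mathcal{C}_2)$ and $l(\mathcal{C}_1 \cup \mathcal{C}_2) \leq l(\mathcal{C}_1) + l(\mathcal{C}_2)$. For $0\le\alpha\le 1$ define $$Q_{\alpha}(\mathcal{P}) = \sum_{\mathcal{C} \in \mathcal{P}} q_{\alpha}(\mathcal{C}), \qquad q_{\alpha}(\mathcal{C}) = \alpha h(\mathcal{C}) + (1-\alpha)l(\mathcal{C}).$$ Then $(Q_{\alpha})_{0\le\alpha\le1}$ is a family of additive multi-scale quality functions.
   Context: $V$ is a finite vertex set of a graph, and a dendrogram on $V$ is given: a rooted tree whose nodes are subsets of $V$, with root $V$, leaves the singletons $\{v\}$, and the children of each internal node pairwise disjoint with union equal to that node. $S$ is the set of node sets of the dendrogram and $\Pi$ is the set of partitions of $V$ all of whose parts belong to $S$. A quality function $Q$ is additive if $Q(\mathcal{P}) = \sum_{\mathcal{C}\in\mathcal{P}} q(\mathcal{C})$ for some function $q$ on subsets of $V$. For partitions, $\mathcal{P}_1 \preceq \mathcal{P}_2$ means every $\mathcal{C}_1\in\mathcal{P}_1$ is contained in some $\mathcal{C}_2\in\mathcal{P}_2$. A family of quality functions $(Q_{\alpha})_{0 \leq \alpha \leq 1}$, with $\mathcal{P}_{\alpha}$ denoting the partition in $\Pi$ maximizing $Q_{\alpha}$, is a multi-scale quality function if $\alpha_1 \leq \alpha_2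 \Rightarrow \mathcal{P}_{\alpha_1} \preceq \mathcal{P}_{\alpha_2}$, and $\mathcal{P}_{0} = \{\{v\}\mid v \in V\}$ and $\mathcal{P}_{1} = \{V\}$.
   Formalization: Since the maximizing partition need not be unique (e.g. h = l = 0), "the partition P_α maximizing Q_α" is read as: there is a choice of one maximizer P_α in Π for each α such that the family is monotone under refinement, with P_0 the singletons and P_1 = {V}. *)

theory Defs
  imports Complex_Main "HOL-Library.Disjoint_Sets"
begin

text \<open>\<^term>\<open>(x, y) \<in> E\<close> means that \<^term>\<open>y\<close> is a child of \<^term>\<open>x\<close>.\<close>

definition rooted_tree :: "'n set \<Rightarrow> ('n \<times> 'n) set \<Rightarrow> 'n \<Rightarrow> bool" where
  "rooted_tree N E r \<longleftrightarrow>
     E \<subseteq> N \<times> N \<and> r \<in> N \<and>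
     (\<forall>x\<in>N. (r, x) \<in> E\<^sup>*) \<and>
     (\<forall>x. (x, r) \<notin> E) \<and>
     (\<forall>y\<in>N - {r}. \<exists>!x. (x, y) \<in> E)"

definition children :: "('n \<times> 'n) set \<Rightarrow> 'n \<Rightarrow> 'n set" where
  "children E x = {y. (x, y) \<in> E}"

definition dendrogram :: "'a set \<Rightarrow> 'a set set \<Rightarrow> ('a set \<times> 'a set) set \<Rightarrow> bool" where
  "dendrogram V S E \<longleftrightarrow>
     S \<subseteq> Pow V \<and>
     rooted_tree S E V \<and>
     {C \<in> S. children E C = {}} = {{v} | v. v \<in> V} \<and>
     (\<forall>C\<in>S. children E C \<noteq> {} \<longrightarrow>
        disjoint (children E C) \<and> \<Union>(children E C) = C)"

definition dendrogram_partitions :: "'a set \<Rightarrow> 'a set set \<Rightarrow> 'a set set set" where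
  "dendrogram_partitions V S = {P. partition_on V P \<and> P \<subseteq> S}"

definition additive_quality :: "'a set \<Rightarrow> ('a set set \<Rightarrow> real) \<Rightarrow> bool" where
  "additive_quality V Q \<longleftrightarrow>
     (\<exists>q :: 'a set \<Rightarrow> real. \<forall>P. partition_on V P \<longrightarrow> Q P = (\<Sum>C\<in>P. q C))"

text \<open>
  Maximizers need not be unique: as the best partition moves from the singletons to
  \<^term>\<open>{V}\<close>, ties necessarily occur at the values of \<^term>\<open>\<alpha>\<close> where it changes.
  So ``the'' maximizing partition is a choice \<^term>\<open>P \<alpha>\<close> of one maximizer for each
  \<^term>\<open>\<alpha>\<close>; wherever the maximizer is unique, the choice is forced.
\<close>

definition multi_scale_quality ::
  "'a set \<Rightarrow> 'a set set \<Rightarrow> (real \<Rightarrow> 'a set set \<Rightarrow> real) \<Rightarrow> bool" where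
  "multi_scale_quality V S Q \<longleftrightarrow>
     (\<exists>P. (\<forall>\<alpha>\<in>{0..1}. is_arg_max (Q \<alpha>) (\<lambda>X. X \<in> dendrogram_partitions V S) (P \<alpha>)) \<and>
          (\<forall>\<alpha>\<^sub>1\<in>{0..1}. \<forall>\<alpha>\<^sub>2\<in>{0..1}. \<alpha>\<^sub>1 \<le> \<alpha>\<^sub>2 \<longrightarrow> refines V (P \<alpha>\<^sub>1) (P \<alpha>\<^sub>2)) \<and>
          P 0 = {{v} | v. v \<in> V} \<and>
          P 1 = {V})"

definition interpolated_quality ::
  "('a set \<Rightarrow> real) \<Rightarrow> ('a set \<Rightarrow> real) \<Rightarrow> real \<Rightarrow> 'a set set \<Rightarrow> real" where
  "interpolated_quality h l \<alpha> P = (\<Sum>C\<in>P. \<alpha> * h C + (1 - \<alpha>) * l C)"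

end

theory Submission
  imports Defs
begin

text \<open>
  Call a nonempty node \<^emph>\<open>\<alpha>-optimal\<close> if no partition of it into nodes has a larger value of
  \<open>q\<^sub>\<alpha>\<close>. The gain from merging a partition of a set into that set is nondecreasing in \<open>\<alpha>\<close>, so an
  \<open>\<alpha>\<close>-optimal node stays optimal when \<open>\<alpha>\<close> grows. The nodes form a laminar family containing the
  singletons, hence the inclusion-maximal \<open>\<alpha>\<close>-optimal nodes partition \<open>V\<close>, and these partitions
  coarsen as \<open>\<alpha>\<close> grows. This partition maximizes \<open>Q\<^sub>\<alpha>\<close>: every part of a maximizer is optimal, so
  the maximizer refines it, and merging its parts inside an optimal node does not decrease \<open>Q\<^sub>\<alpha>\<close>.
  At \<open>\<alpha> = 1\<close> every node is optimal. At \<open>\<alpha> = 0\<close> larger nodes may tie with the singletons,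
  so there the singleton partition is chosen by hand.
\<close>

section \<open>Set functions summed over partitions\<close>

lemma superadditive_sum_le:
  fixes h :: "'a set \<Rightarrow> real"
  assumes super: "\<And>A B. A \<subseteq> V \<Longrightarrow> B \<subseteq> V \<Longrightarrow> A \<inter> B = {} \<Longrightarrow> h A + h B \<le> h (A \<union> B)"
    and "finite V" "C \<subseteq> V" "C \<noteq> {}" and Y: "partition_on C Y"
  shows "sum h Y \<le> h C"
proof -
  have C: "C = \<Union>Y" and "disjoint Y"
    using Y by (auto simp: partition_on_def)
  \<comment> \<open>The induction starts from one part: superadditivity gives only
    \<open>h {} <= 0\<close>, so the bound can fail for the empty partition of
    \<open>{}\<close>.\<close>
  have "finite Y" "Y \<noteq> {}" "\<Union>Y \<subseteq> V"
    using assms C by (auto simp: finite_subset intro: finite_UnionD)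
  then have "sum h Y \<le> h (\<Union>Y)" using \<open>disjoint Y\<close>
  proof (induction Y rule: finite_ne_induct)
    case (singleton A)
    then show ?case by simp
  next
    case (insert A Y)
    have "A \<inter> \<Union>Y = {}"
      using insert.prems insert.hyps by (auto simp: pairwise_insert disjnt_def)
    then have "h A + h (\<Union>Y) \<le> h (A \<union> \<Union>Y)"
      using insert.prems by (intro super) auto
    moreover have "sum h Y \<le> h (\<Union>Y)"
      using insert by (auto simp: pairwise_insert)
    ultimately show ?case using insert.hyps by simp
  qed
  then show ?thesis by (simp add: C)
qed

text \<open>Grouping the parts of \<open>X\<close> by the part of \<open>M\<close> that contains
  them turns the left side into a double sum, which \<open>le\<close> bounds block by block. The
  premise \<open>Y \<subseteq> X\<close> in \<open>le\<close> lets properties of the parts of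
  \<open>X\<close>, such as being nodes, carry over to each block.\<close>

lemma sum_le_sum_coarser:
  fixes f g :: "'a set \<Rightarrow> real"
  assumes "finite V" and ref: "refines V X M"
    and le: "\<And>C Y. C \<in> M \<Longrightarrow> Y \<subseteq> X \<Longrightarrow> partition_on C Y \<Longrightarrow> sum f Y \<le> g C"
  shows "sum f X \<le> sum g M"
proof -
  have X: "partition_on V X" and M: "partition_on V M"
    and sub: "\<And>D. D \<in> X \<Longrightarrow> \<exists>C\<in>M. D \<subseteq> C"
    using ref by (auto simp: refines_def)
  have fin: "finite X" "finite M"
    using X M \<open>finite V\<close> by (auto intro: finite_elements)
  have same: "C = C'" if "C \<in> M" "C' \<in> M" "x \<in> C" "x \<in> C'" for C C' x
    using that M by (auto simp: partition_on_def disjoint_def)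
  define Y where "Y C = {D \<in> X. D \<subseteq> C}" for C
  have part: "partition_on C (Y C)" if "C \<in> M" for C
  proof (rule partition_onI)
    show "\<Union>(Y C) = C"
    proof
      show "C \<subseteq> \<Union>(Y C)"
      proof
        fix x assume "x \<in> C"
        then have "x \<in> V" using M that by (auto simp: partition_on_def)
        then obtain D where "D \<in> X" "x \<in> D" using X by (auto simp: partition_on_def)
        \<comment> \<open>\<open>C'\<close> must be \<open>C\<close>, since both parts of
          \<open>M\<close> contain \<open>x\<close>.\<close>
        moreover obtain C' where "C' \<in> M" "D \<subseteq> C'" using sub \<open>D \<in> X\<close> by blast
        ultimately show "x \<in> \<Union>(Y C)"
          using same[of C C' x] that \<open>x \<in> C\<close> by (auto simp: Y_def)
      qed
    qed (auto simp: Y_def)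
    show "disjnt D D'" if "D \<in> Y C" "D' \<in> Y C" "D \<noteq> D'" for D D'
      using that X by (auto simp: Y_def partition_on_def pairwise_def)
    show "{} \<notin> Y C"
      using X by (auto simp: Y_def partition_on_def)
  qed
  have X_eq: "X = (\<Union>C\<in>M. Y C)"
    using sub by (auto simp: Y_def)
  have "sum f X = (\<Sum>C\<in>M. sum f (Y C))"
    unfolding X_eq
  proof (rule sum.UNION_disjoint)
    show "\<forall>C\<in>M. \<forall>C'\<in>M. C \<noteq> C' \<longrightarrow> Y C \<inter> Y C' = {}"
    proof (intro ballI impI equals0I)
      fix C C' D assume "C \<in> M" "C' \<in> M" "C \<noteq> C'" and D: "D \<in> Y C \<inter> Y C'"
      have "D \<noteq> {}" using D X by (auto simp: Y_def partition_on_def)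
      then obtain x where "x \<in> D" by blast
      then show False using D same[of C C' x] \<open>C \<in> M\<close> \<open>C' \<in> M\<close> \<open>C \<noteq> C'\<close> by (auto simp: Y_def)
    qed
  qed (use fin in \<open>auto simp: Y_def\<close>)
  also have "\<dots> \<le> sum g M"
    using part by (intro sum_mono le) (auto simp: Y_def)
  finally show ?thesis .
qed

text \<open>The exchange move used to test a single part of a maximizer. The second claim makes sums
  split exactly: a common part would be nonempty, inside \<open>C\<close> and disjoint from
  \<open>C\<close>.\<close>

lemma partition_on_replace_part:
  assumes X: "partition_on V X" and "C \<in> X" and Y: "partition_on C Y"
  shows "partition_on V (X - {C} \<union> Y)" and "(X - {C}) \<inter> Y = {}"
proof -
  have dj: "D \<inter> C = {}" if "D \<in> X - {C}" for D
    using that X \<open>C \<in> X\<close> by (auto simp: partition_on_def disjoint_def)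
  have Y_sub: "D \<subseteq> C" if "D \<in> Y" for D
    using that Y by (auto simp: partition_on_def)
  show "partition_on V (X - {C} \<union> Y)"
  proof (rule partition_onI)
    have "\<Union>(X - {C} \<union> Y) = \<Union>(X - {C}) \<union> C"
      using Y by (auto simp: partition_on_def)
    also have "\<dots> = V"
      using X \<open>C \<in> X\<close> by (auto simp: partition_on_def)
    finally show "\<Union>(X - {C} \<union> Y) = V" .
    show "{} \<notin> X - {C} \<union> Y"
      using X Y by (auto simp: partition_on_def)
    fix D D' assume "D \<in> X - {C} \<union> Y" "D' \<in> X - {C} \<union> Y" "D \<noteq> D'"
    then consider "D \<in> X" "D' \<in> X" | "D \<in> Y" "D' \<in> Y"
      | "D \<in> X - {C}" "D' \<in> Y" | "D \<in> Y" "D' \<in> X - {C}"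
      by blast
    then show "disjnt D D'"
    proof cases
      case 1
      then show ?thesis using X \<open>D \<noteq> D'\<close> by (auto simp: partition_on_def pairwise_def)
    next
      case 2
      then show ?thesis using Y \<open>D \<noteq> D'\<close> by (auto simp: partition_on_def pairwise_def)
    next
      case 3
      then show ?thesis using dj[of D] Y_sub[of D'] by (auto simp: disjnt_def)
    next
      case 4
      then show ?thesis using dj[of D'] Y_sub[of D] by (auto simp: disjnt_def)
    qed
  qed
  show "(X - {C}) \<inter> Y = {}"
  proof (rule equals0I)
    fix D assume "D \<in> (X - {C}) \<inter> Y"
    then have "D \<inter> C = {}" "D \<subseteq> C" "D \<noteq> {}"
      using dj Y by (auto simp: partition_on_def)
    then show False by auto
  qed
qed

lemma partition_on_singletons: "partition_on V {{v} | v. v \<in> V}"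
  by (auto simp: partition_on_def disjoint_def)

lemma partition_on_singleton_eq:
  assumes "partition_on {v} Y"
  shows "Y = {{v}}"
proof -
  have "D = {v}" if "D \<in> Y" for D
  proof -
    have "D \<subseteq> {v}" "D \<noteq> {}" using that assms by (auto simp: partition_on_def)
    then show ?thesis by (simp add: subset_singleton_iff)
  qed
  moreover have "Y \<noteq> {}" using assms by (auto simp: partition_on_def)
  ultimately show ?thesis by blast
qed

section \<open>Optimal nodes of a laminar family\<close>

definition optimal_nodes :: "'a set set \<Rightarrow> ('a set \<Rightarrow> real) \<Rightarrow> 'a set set" where
  "optimal_nodes S q =
     {C \<in> S. C \<noteq> {} \<and> (\<forall>Y. partition_on C Y \<and> Y \<subseteq> S \<longrightarrow> sum q Y \<le> q C)}"

definition maximal_optimal_nodes :: "'a set set \<Rightarrow> ('a set \<Rightarrow> real) \<Rightarrow> 'a set set" where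
  "maximal_optimal_nodes S q =
     {C \<in> optimal_nodes S q. \<forall>D\<in>optimal_nodes S q. C \<subseteq> D \<longrightarrow> C = D}"

text \<open>What the optimization needs from a dendrogram, with the tree edges forgotten.
  \<open>V_nonempty\<close> makes \<open>{V}\<close> a partition of \<open>V\<close>.\<close>

locale laminar_family =
  fixes V :: "'a set" and S :: "'a set set"
  assumes finite_V: "finite V"
    and subset_V: "C \<in> S \<Longrightarrow> C \<subseteq> V"
    and V_in: "V \<in> S"
    and V_nonempty: "V \<noteq> {}"
    and singleton_in: "v \<in> V \<Longrightarrow> {v} \<in> S"
    and laminar: "A \<in> S \<Longrightarrow> B \<in> S \<Longrightarrow> A \<subseteq> B \<or> B \<subseteq> A \<or> A \<inter> B = {}"
begin

lemma finite_S: "finite S"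
  using finite_V subset_V by (auto intro: finite_subset[of S "Pow V"])

lemma optimal_node_le_maximal:
  assumes "C \<in> optimal_nodes S q"
  obtains M where "M \<in> maximal_optimal_nodes S q" "C \<subseteq> M"
proof -
  have "finite (optimal_nodes S q)"
    using finite_S by (simp add: optimal_nodes_def)
  from finite_has_maximal2[OF this assms] show ?thesis
    using that by (auto simp: maximal_optimal_nodes_def)
qed

text \<open>Distinct maximal nodes are incomparable, so laminarity makes them disjoint. They cover
  \<open>V\<close> because a singleton has only the trivial partition and is therefore
  optimal.\<close>

lemma partition_on_maximal_optimal_nodes: "partition_on V (maximal_optimal_nodes S q)"
proof (rule partition_onI)
  show "\<Union>(maximal_optimal_nodes S q) = V"
  proof
    show "\<Union>(maximal_optimal_nodes S q) \<subseteq> V"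
      using subset_V by (auto simp: maximal_optimal_nodes_def optimal_nodes_def)
    show "V \<subseteq> \<Union>(maximal_optimal_nodes S q)"
    proof
      fix v assume "v \<in> V"
      then have "{v} \<in> optimal_nodes S q"
        using singleton_in by (auto simp: optimal_nodes_def dest: partition_on_singleton_eq)
      then show "v \<in> \<Union>(maximal_optimal_nodes S q)"
        by (rule optimal_node_le_maximal) auto
    qed
  qed
  show "disjnt A B" if "A \<in> maximal_optimal_nodes S q" "B \<in> maximal_optimal_nodes S q" "A \<noteq> B" for A B
    using that laminar[of A B]
    by (auto simp: maximal_optimal_nodes_def optimal_nodes_def disjnt_def)
  show "{} \<notin> maximal_optimal_nodes S q"
    by (auto simp: maximal_optimal_nodes_def optimal_nodes_def)
qed

lemma refines_maximal_optimal_nodes: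
  assumes "partition_on V X" "X \<subseteq> optimal_nodes S q"
  shows "refines V X (maximal_optimal_nodes S q)"
  unfolding refines_def
proof (intro conjI ballI)
  fix C assume "C \<in> X"
  with assms have "C \<in> optimal_nodes S q" by auto
  then show "\<exists>M\<in>maximal_optimal_nodes S q. C \<subseteq> M"
    by (rule optimal_node_le_maximal) auto
qed (use assms partition_on_maximal_optimal_nodes in auto)

lemma maximal_optimal_nodes_in_partitions:
  "maximal_optimal_nodes S q \<in> dendrogram_partitions V S"
  using partition_on_maximal_optimal_nodes
  by (auto simp: dendrogram_partitions_def maximal_optimal_nodes_def optimal_nodes_def)

text \<open>Exchanging a part \<open>C\<close> for \<open>Y\<close> gives another admissible
  partition and changes the value by \<open>sum q Y - q C\<close>, which cannot be positive at a
  maximizer.\<close>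

lemma maximizer_parts_optimal:
  assumes max: "is_arg_max (sum q) (\<lambda>X. X \<in> dendrogram_partitions V S) X"
  shows "X \<subseteq> optimal_nodes S q"
proof
  fix C assume "C \<in> X"
  have X: "partition_on V X" "X \<subseteq> S"
    using max by (auto simp: is_arg_max_def dendrogram_partitions_def)
  have "sum q Y \<le> q C" if Y: "partition_on C Y" "Y \<subseteq> S" for Y
  proof -
    note rep = partition_on_replace_part[OF X(1) \<open>C \<in> X\<close> Y(1)]
    have fin: "finite X" "finite Y"
      using X Y finite_S by (auto intro: finite_subset)
    have "X - {C} \<union> Y \<in> dendrogram_partitions V S"
      using rep X Y by (auto simp: dendrogram_partitions_def)
    then have "sum q (X - {C} \<union> Y) \<le> sum q X"
      using max by (auto simp: is_arg_max_linorder)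
    moreover have "sum q (X - {C} \<union> Y) = sum q (X - {C}) + sum q Y"
      using fin rep by (intro sum.union_disjoint) auto
    moreover have "sum q X = q C + sum q (X - {C})"
      using fin(1) \<open>C \<in> X\<close> by (rule sum.remove)
    ultimately show ?thesis by simp
  qed
  then show "C \<in> optimal_nodes S q"
    using X \<open>C \<in> X\<close> by (auto simp: optimal_nodes_def partition_on_def)
qed

lemma maximal_optimal_nodes_maximize:
  "is_arg_max (sum q) (\<lambda>X. X \<in> dendrogram_partitions V S) (maximal_optimal_nodes S q)"
proof -
  have "finite (dendrogram_partitions V S)"
    using finite_S by (auto simp: dendrogram_partitions_def intro: finite_subset[of _ "Pow S"])
  \<comment> \<open>Existence on a finite nonempty set, obtained by minimizing the negated
    sum.\<close>
  then have "\<exists>X. is_arg_min (\<lambda>X. - sum q X) (\<lambda>X. X \<in> dendrogram_partitions V S) X"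
    using maximal_optimal_nodes_in_partitions by (intro ex_is_arg_min_if_finite) auto
  then obtain X where X: "is_arg_max (sum q) (\<lambda>X. X \<in> dendrogram_partitions V S) X"
    by (auto simp: is_arg_min_def is_arg_max_def)
  have part: "partition_on V X" "X \<subseteq> S"
    using X by (auto simp: is_arg_max_def dendrogram_partitions_def)
  have "sum q X \<le> sum q (maximal_optimal_nodes S q)"
  proof (rule sum_le_sum_coarser[OF finite_V])
    show "refines V X (maximal_optimal_nodes S q)"
      using refines_maximal_optimal_nodes[OF part(1) maximizer_parts_optimal[OF X]] .
    show "sum q Y \<le> q C"
      if "C \<in> maximal_optimal_nodes S q" "Y \<subseteq> X" "partition_on C Y" for C Y
      using that part by (auto simp: maximal_optimal_nodes_def optimal_nodes_def)
  qed
  then show ?thesis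
    using X maximal_optimal_nodes_in_partitions
    by (auto simp: is_arg_max_linorder intro: order_trans)
qed

section \<open>Monotonicity in the scale parameter\<close>

theorem multi_scale_interpolated_quality:
  fixes h l :: "'a set \<Rightarrow> real"
  assumes super: "\<And>A B. A \<subseteq> V \<Longrightarrow> B \<subseteq> V \<Longrightarrow> A \<inter> B = {} \<Longrightarrow> h A + h B \<le> h (A \<union> B)"
    and sub: "\<And>A B. A \<subseteq> V \<Longrightarrow> B \<subseteq> V \<Longrightarrow> A \<inter> B = {} \<Longrightarrow> l (A \<union> B) \<le> l A + l B"
  shows "multi_scale_quality V S (interpolated_quality h l)"
proof -
  define q where "q \<alpha> C = \<alpha> * h C + (1 - \<alpha>) * l C" for \<alpha> C
  have quality: "interpolated_quality h l \<alpha> = sum (q \<alpha>)" for \<alpha>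
    by (simp add: interpolated_quality_def q_def fun_eq_iff)
  have h_le: "sum h Y \<le> h C" if "C \<subseteq> V" "C \<noteq> {}" "partition_on C Y" for C Y
    using super finite_V that by (rule superadditive_sum_le)
  have l_ge: "l C \<le> sum l Y" if "C \<subseteq> V" "C \<noteq> {}" "partition_on C Y" for C Y
  proof -
    \<comment> \<open>Subadditivity of \<open>l\<close> is superadditivity of
      \<open>- l\<close>.\<close>
    have "- l A + - l B \<le> - l (A \<union> B)" if "A \<subseteq> V" "B \<subseteq> V" "A \<inter> B = {}" for A B
      using sub[OF that] by simp
    then have "(\<Sum>D\<in>Y. - l D) \<le> - l C"
      using finite_V that by (rule superadditive_sum_le)
    then show ?thesis by (simp add: sum_negf)
  qed
  define Sing where "Sing = {{v} | v. v \<in> V}"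
  have Sing: "partition_on V Sing"
    unfolding Sing_def by (rule partition_on_singletons)
  have Sing_refines: "refines V Sing X" if "partition_on V X" for X
    using that Sing by (auto simp: refines_def Sing_def partition_on_def)
  have Sing_max: "is_arg_max (sum (q 0)) (\<lambda>X. X \<in> dendrogram_partitions V S) Sing"
    unfolding is_arg_max_linorder
  proof (intro conjI allI impI)
    show "Sing \<in> dendrogram_partitions V S"
      using Sing singleton_in by (auto simp: dendrogram_partitions_def Sing_def)
    fix X assume "X \<in> dendrogram_partitions V S"
    then have X: "partition_on V X" by (simp add: dendrogram_partitions_def)
    \<comment> \<open>At scale 0 only \<open>l\<close> counts, and splitting a part never lowers the
      sum of \<open>l\<close>; the singletons are the finest partition.\<close>
    have "(\<Sum>C\<in>Sing. - l C) \<le> (\<Sum>C\<in>X. - l C)"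
    proof (rule sum_le_sum_coarser[OF finite_V Sing_refines[OF X]])
      fix C Y assume "C \<in> X" "partition_on C Y"
      then have "l C \<le> sum l Y"
        using X by (intro l_ge) (auto simp: partition_on_def)
      then show "(\<Sum>D\<in>Y. - l D) \<le> - l C" by (simp add: sum_negf)
    qed
    then show "sum (q 0) X \<le> sum (q 0) Sing"
      by (simp add: q_def sum_negf)
  qed
  have mono: "optimal_nodes S (q \<alpha>) \<subseteq> optimal_nodes S (q \<beta>)" if "\<alpha> \<le> \<beta>" for \<alpha> \<beta>
  proof
    fix C assume C: "C \<in> optimal_nodes S (q \<alpha>)"
    have "sum (q \<beta>) Y \<le> q \<beta> C" if Y: "partition_on C Y" "Y \<subseteq> S" for Y
    proof -
      have sum_q: "sum (q \<gamma>) Y = \<gamma> * sum h Y + (1 - \<gamma>) * sum l Y" for \<gamma>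
        by (simp add: q_def sum.distrib sum_distrib_left)
      have CV: "C \<subseteq> V" "C \<noteq> {}"
        using C subset_V by (auto simp: optimal_nodes_def)
      \<comment> \<open>The right side is the growth, from \<alpha> to \<beta>, of the gain from
        merging \<open>Y\<close> into \<open>C\<close>; the gain is affine in the scale, with this
        nonnegative bracket as slope.\<close>
      have "0 \<le> (\<beta> - \<alpha>) * ((h C - sum h Y) + (sum l Y - l C))"
        using \<open>\<alpha> \<le> \<beta>\<close> h_le[OF CV Y(1)] l_ge[OF CV Y(1)] by simp
      also have "\<dots> = (q \<beta> C - sum (q \<beta>) Y) - (q \<alpha> C - sum (q \<alpha>) Y)"
        unfolding sum_q by (simp add: q_def algebra_simps)
      finally show ?thesis
        using C Y by (auto simp: optimal_nodes_def)
    qed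
    then show "C \<in> optimal_nodes S (q \<beta>)"
      using C by (auto simp: optimal_nodes_def)
  qed
  \<comment> \<open>The exception at 0 matters: if \<open>l\<close> vanishes, every nonempty node is
    optimal there and the maximal one is \<open>V\<close>.\<close>
  define P where "P \<alpha> = (if \<alpha> = 0 then Sing else maximal_optimal_nodes S (q \<alpha>))" for \<alpha>
  have P_part: "partition_on V (P \<alpha>)" for \<alpha>
    by (simp add: P_def Sing partition_on_maximal_optimal_nodes)
  have "refines V (P \<alpha>) (P \<beta>)" if "0 \<le> \<alpha>" "\<alpha> \<le> \<beta>" for \<alpha> \<beta>
  proof (cases "\<alpha> = 0")
    case True
    then show ?thesis using Sing_refines[OF P_part] by (simp add: P_def)
  next
    case False
    \<comment> \<open>Parts of \<open>P \<alpha>\<close> need not be maximal at scale \<beta>, but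
      they stay optimal, which suffices for refinement.\<close>
    then have "P \<alpha> \<subseteq> optimal_nodes S (q \<beta>)"
      using mono[OF \<open>\<alpha> \<le> \<beta>\<close>] by (auto simp: P_def maximal_optimal_nodes_def)
    from refines_maximal_optimal_nodes[OF P_part this] show ?thesis
      using False that by (simp add: P_def)
  qed
  moreover have "is_arg_max (sum (q \<alpha>)) (\<lambda>X. X \<in> dendrogram_partitions V S) (P \<alpha>)" for \<alpha>
    using Sing_max maximal_optimal_nodes_maximize by (simp add: P_def)
  moreover have "P 1 = {V}"
  proof -
    have "q 1 = h" by (simp add: q_def fun_eq_iff)
    then have "V \<in> optimal_nodes S (q 1)"
      using V_in V_nonempty h_le by (auto simp: optimal_nodes_def)
    moreover have "C \<subseteq> V" if "C \<in> optimal_nodes S (q 1)" for C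
      using that subset_V by (auto simp: optimal_nodes_def)
    ultimately have "maximal_optimal_nodes S (q 1) = {V}"
      unfolding maximal_optimal_nodes_def by blast
    then show ?thesis by (simp add: P_def)
  qed
  moreover have "P 0 = {{v} | v. v \<in> V}"
    by (simp add: P_def Sing_def)
  ultimately show ?thesis
    unfolding multi_scale_quality_def quality by (intro exI[of _ P]) auto
qed

end

section \<open>Dendrograms are laminar families\<close>

lemma dendrogram_child_subset:
  assumes "dendrogram V S E" "(A, B) \<in> E"
  shows "B \<subseteq> A"
proof -
  have "A \<in> S" "B \<in> children E A"
    using assms by (auto simp: dendrogram_def rooted_tree_def children_def)
  moreover from this have "children E A \<noteq> {}" by auto
  ultimately have "\<Union>(children E A) = A"
    using assms(1) by (simp add: dendrogram_def)
  then show ?thesis using \<open>B \<in> children E A\<close> by auto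
qed

lemma dendrogram_descendant_subset:
  assumes "dendrogram V S E" "(A, B) \<in> E\<^sup>*"
  shows "B \<subseteq> A"
  using assms(2) by induction (use dendrogram_child_subset[OF assms(1)] in auto)

text \<open>Induction along the path from the root to \<open>A\<close>. When the path steps from a
  proper ancestor of \<open>B\<close> to a child, that child is either the one leading to
  \<open>B\<close> or a sibling disjoint from it, hence from \<open>B\<close>.\<close>

lemma dendrogram_ancestor_or_disjoint:
  assumes D: "dendrogram V S E" and "A \<in> S" "B \<in> S"
  shows "(A, B) \<in> E\<^sup>* \<or> (B, A) \<in> E\<^sup>* \<or> A \<inter> B = {}"
proof -
  have reach: "(V, C) \<in> E\<^sup>*" if "C \<in> S" for C
    using D that by (auto simp: dendrogram_def rooted_tree_def)
  from reach[OF \<open>A \<in> S\<close>] show ?thesis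
  proof induction
    case base
    then show ?case using reach[OF \<open>B \<in> S\<close>] by simp
  next
    case (step A A')
    have "A' \<subseteq> A" using dendrogram_child_subset[OF D step.hyps(2)] .
    consider "(B, A) \<in> E\<^sup>*" | "A \<inter> B = {}" | A'' where "(A, A'') \<in> E" "(A'', B) \<in> E\<^sup>*"
      using step.IH by (auto elim: converse_rtranclE)
    then show ?case
    proof cases
      case 1
      then show ?thesis using step.hyps(2) by (auto intro: rtrancl_into_rtrancl)
    next
      case 2
      then show ?thesis using \<open>A' \<subseteq> A\<close> by auto
    next
      case 3
      have "A \<in> S" using D step.hyps(2) by (auto simp: dendrogram_def rooted_tree_def)
      moreover have ch: "A' \<in> children E A" "A'' \<in> children E A"
        using step.hyps(2) 3(1) by (auto simp: children_def)
      ultimately have "disjoint (children E A)"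
        using D by (auto simp: dendrogram_def)
      then have "A' = A'' \<or> A' \<inter> A'' = {}"
        using ch by (auto simp: disjoint_def)
      then show ?thesis
        using 3(2) dendrogram_descendant_subset[OF D 3(2)] by auto
    qed
  qed
qed

lemma dendrogram_laminar_family:
  assumes "finite V" and D: "dendrogram V S E"
  shows "laminar_family V S"
proof
  show "C \<subseteq> V" if "C \<in> S" for C
    using D that by (auto simp: dendrogram_def)
  show V: "V \<in> S"
    using D by (auto simp: dendrogram_def rooted_tree_def)
  have leaves: "{C \<in> S. children E C = {}} = {{v} | v. v \<in> V}"
    using D by (simp add: dendrogram_def)
  show "V \<noteq> {}"
  proof
    \<comment> \<open>The root would be the only node. No edge enters the root, so it would be a
      leaf, yet leaves are singletons of elements of \<open>V\<close>.\<close>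
    assume "V = {}"
    then have "S \<subseteq> {V}" using D by (auto simp: dendrogram_def)
    then have "children E V = {}"
      using D by (auto simp: dendrogram_def rooted_tree_def children_def)
    then show False using leaves V \<open>V = {}\<close> by auto
  qed
  show "{v} \<in> S" if "v \<in> V" for v
    using leaves that by auto
  show "A \<subseteq> B \<or> B \<subseteq> A \<or> A \<inter> B = {}" if "A \<in> S" "B \<in> S" for A B
    using dendrogram_ancestor_or_disjoint[OF D that] dendrogram_descendant_subset[OF D] by blast
qed (fact assms)

theorem theorem2:
  fixes V :: "'a set" and S :: "'a set set" and E :: "('a set \<times> 'a set) set"
    and h l :: "'a set \<Rightarrow> real"
  assumes "finite V"
    and "dendrogram V S E"
    and "\<And>C\<^sub>1 C\<^sub>2. C\<^sub>1 \<subseteq> V \<Longrightarrow> C\<^sub>2 \<subseteq> V \<Longrightarrow> C\<^sub>1 \<inter> C\<^sub>2 = {} \<Longrightarrow> h (C\<^sub>1 \<union> C\<^sub>2) \<ge> h C\<^sub>1 + h C\<^sub>2"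
    and "\<And>C\<^sub>1 C\<^sub>2. C\<^sub>1 \<subseteq> V \<Longrightarrow> C\<^sub>2 \<subseteq> V \<Longrightarrow> C\<^sub>1 \<inter> C\<^sub>2 = {} \<Longrightarrow> l (C\<^sub>1 \<union> C\<^sub>2) \<le> l C\<^sub>1 + l C\<^sub>2"
  shows "(\<forall>\<alpha>\<in>{0..1}. additive_quality V (interpolated_quality h l \<alpha>)) \<and>
         multi_scale_quality V S (interpolated_quality h l)"
proof
  show "\<forall>\<alpha>\<in>{0..1}. additive_quality V (interpolated_quality h l \<alpha>)"
    unfolding additive_quality_def interpolated_quality_def by blast
  interpret laminar_family V S
    using assms(1,2) by (rule dendrogram_laminar_family)
  show "multi_scale_quality V S (interpolated_quality h l)"
    using assms(3,4) by (rule multi_scale_interpolated_quality)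
qed

end
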